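(* Let $(\nu,x_0)\in\Omega$. (1) The tower $(K_n)_{n\ge1}$ is thin. (2) The tower $(K_n)_{n\ge0}$ is thin if and only if $u_0-x_0$ is not a square (of an integer).
   Context: For integers $\nu\ge2$ and $x_0\ge0$, define $x_{n+1}=\pm\sqrt{\nu+x_n}$ for $n\ge0$ (any choice of sign at each step), $K_n=\mathbb{Q}(x_n)$ and $K=\bigcup_{n\ge0}K_n$. $\Omega$ is the set of pairs $(\nu,x_0)$ such that $[K_{n+1}:K_n]=2$ for every $n\ge0$ and $K$ is totally real. $u_0=\nu^2-\nu$. A tower $(K_n)_{n\ge m}$ is thin if the only finite extensions of $K_m$ contained in $K$ are the fields $K_n$, $n\ge m$. *)

theory Defs
  imports Complex_Main "HOL-Algebra.Algebraic_Closure_Type" "HOL-Algebra.Generated_Fields"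
    "HOL-Algebra.Embedded_Algebras"
begin

abbreviation complex_ring :: "complex ring"
  where "complex_ring \<equiv> ring_of_type_algebra"

(* The sequence lives in the complex numbers, since the radicands are not known to be nonnegative
   reals in advance; s n selects the sign of the square root taken at step n. *)
primrec nested_root :: "(nat \<Rightarrow> bool) \<Rightarrow> int \<Rightarrow> int \<Rightarrow> nat \<Rightarrow> complex" where
  "nested_root s \<nu> x0 0 = of_int x0"
| "nested_root s \<nu> x0 (Suc n) =
     (if s n then csqrt (of_int \<nu> + nested_root s \<nu> x0 n)
      else - csqrt (of_int \<nu> + nested_root s \<nu> x0 n))"

definition tower_field :: "(nat \<Rightarrow> bool) \<Rightarrow> int \<Rightarrow> int \<Rightarrow> nat \<Rightarrow> complex set" where
  "tower_field s \<nu> x0 n = generate_field complex_ring (\<rat> \<union> {nested_root s \<nu> x0 n})"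

definition totally_real :: "complex set \<Rightarrow> bool" where
  "totally_real L \<longleftrightarrow>
     (\<forall>\<sigma> \<in> ring_hom (complex_ring\<lparr>carrier := L\<rparr>) complex_ring. \<sigma> ` L \<subseteq> \<real>)"

definition Omega :: "(nat \<Rightarrow> bool) \<Rightarrow> (int \<times> int) set" where
  "Omega s = {(\<nu>, x0). \<nu> \<ge> 2 \<and> x0 \<ge> 0 \<and>
     (\<forall>n. ring.dimension complex_ring 2 (tower_field s \<nu> x0 n) (tower_field s \<nu> x0 (Suc n))) \<and>
     totally_real (\<Union>n. tower_field s \<nu> x0 n)}"

definition thin_tower :: "(nat \<Rightarrow> complex set) \<Rightarrow> nat \<Rightarrow> bool" where
  "thin_tower F m \<longleftrightarrow>
     {L. subfield L complex_ring \<and> F m \<subseteq> L \<and> ring.finite_dimension complex_ring (F m) L \<and>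
         L \<subseteq> (\<Union>n. F n)} = F ` {m..}"

end

theory Submission
  imports Defs
begin

text \<open>
  The extension \<open>K\<^sub>i\<^sub>+\<^sub>2 / K\<^sub>i\<close> is generated by a square root of \<open>\<nu> + x\<^sub>i\<^sub>+\<^sub>1\<close>, whose norm to \<open>K\<^sub>i\<close>
  is \<open>u\<^sub>0 - x\<^sub>i\<close>; it has an intermediate field other than \<open>K\<^sub>i\<^sub>+\<^sub>1\<close> exactly if \<open>u\<^sub>0 - x\<^sub>i\<close> is a square
  in \<open>K\<^sub>i\<close>. If this happens for no \<open>i \<ge> m\<close>, then \<open>K\<^sub>j\<^sub>+\<^sub>1\<close> is the only quadratic extension of \<open>K\<^sub>j\<close>
  inside \<open>K\<close> for \<open>j \<ge> m\<close>. A subfield \<open>M\<close> of index two in \<open>K\<^sub>n\<^sub>+\<^sub>1\<close> which meets \<open>K\<^sub>n\<close> in \<open>K\<^sub>j\<close>, \<open>j < n\<close>,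
  satisfies \<open>K\<^sub>n\<^sub>+\<^sub>1 = M(x\<^sub>j\<^sub>+\<^sub>1)\<close>, and the norm of \<open>x\<^sub>j\<^sub>+\<^sub>2\<close> to \<open>M\<close> is then a square root of
  \<open>u\<^sub>0 - x\<^sub>j\<close> lying in \<open>M \<inter> K\<^sub>j\<^sub>+\<^sub>1 = K\<^sub>j\<close>, which is impossible; hence thinness.

  Total reality forces \<open>x\<^sub>0 \<le> u\<^sub>0\<close>. If \<open>u\<^sub>0 - x\<^sub>n\<close> is a square in \<open>K\<^sub>n\<close> for some \<open>n \<ge> 1\<close>, its norm to
  the rationals is a square of the form \<open>u\<^sup>2 - (\<nu> + x\<^sub>0)\<close> with an integer \<open>u \<ge> u\<^sub>0\<close>; for \<open>\<nu> \<ge> 3\<close> this lies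
  strictly between \<open>(u - 1)\<^sup>2\<close> and \<open>u\<^sup>2\<close>. The case \<open>\<nu> = 2\<close> is special because there the sequence
  of the \<open>u\<close> is constant.
\<close>

section \<open>Subfields and adjunction of square roots\<close>

text \<open>A version without ring records, so that the algebra runs in type classes;
  \<open>subfield_complex_ring_iff\<close> ties it to \<open>subfield\<close>. The inverse clause is
  harmless at zero, as \<open>inverse 0 = 0\<close>.\<close>

definition is_subfield :: "'a::field_char_0 set \<Rightarrow> bool" where
  "is_subfield F \<longleftrightarrow> 1 \<in> F \<and> (\<forall>a\<in>F. \<forall>b\<in>F. a - b \<in> F \<and> a * b \<in> F) \<and> (\<forall>a\<in>F. inverse a \<in> F)"

text \<open>The span of 1 and \<open>y\<close> over \<open>F\<close>. It is a field when
  \<open>y\<close> squares into \<open>F\<close>, and its coordinates are unique when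
  \<open>y\<close> lies outside \<open>F\<close>.\<close>

definition adjoin :: "'a::field_char_0 set \<Rightarrow> 'a \<Rightarrow> 'a set" where
  "adjoin F y = {a + b * y | a b. a \<in> F \<and> b \<in> F}"

lemma subfield_closed:
  assumes "is_subfield F"
  shows subfield_1: "1 \<in> F"
    and subfield_0: "0 \<in> F"
    and subfield_diff: "\<And>a b. a \<in> F \<Longrightarrow> b \<in> F \<Longrightarrow> a - b \<in> F"
    and subfield_minus: "\<And>a. a \<in> F \<Longrightarrow> - a \<in> F"
    and subfield_add: "\<And>a b. a \<in> F \<Longrightarrow> b \<in> F \<Longrightarrow> a + b \<in> F"
    and subfield_mult: "\<And>a b. a \<in> F \<Longrightarrow> b \<in> F \<Longrightarrow> a * b \<in> F"
    and subfield_inverse: "\<And>a. a \<in> F \<Longrightarrow> inverse a \<in> F"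
    and subfield_divide: "\<And>a b. a \<in> F \<Longrightarrow> b \<in> F \<Longrightarrow> a / b \<in> F"
    and subfield_power: "\<And>a n. a \<in> F \<Longrightarrow> a ^ n \<in> F"
proof -
  show 1: "1 \<in> F" and diff: "\<And>a b. a \<in> F \<Longrightarrow> b \<in> F \<Longrightarrow> a - b \<in> F"
    and mult: "\<And>a b. a \<in> F \<Longrightarrow> b \<in> F \<Longrightarrow> a * b \<in> F"
    and inverse: "\<And>a. a \<in> F \<Longrightarrow> inverse a \<in> F"
    using assms by (auto simp: is_subfield_def)
  show 0: "0 \<in> F"
    using diff[OF 1 1] by simp
  show minus: "- a \<in> F" if "a \<in> F" for a
    using diff[OF 0 that] by simp
  show "a + b \<in> F" if "a \<in> F" "b \<in> F" for a b
    using diff[OF that(1) minus[OF that(2)]] by simp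
  show "a / b \<in> F" if "a \<in> F" "b \<in> F" for a b
    using mult[OF that(1) inverse[OF that(2)]] by (simp add: divide_inverse)
  show "a ^ n \<in> F" if "a \<in> F" for a n
    by (induction n) (auto intro: 1 mult that)
qed

lemma subfield_of_int: "of_int k \<in> F" if F: "is_subfield F"
proof -
  have nat: "of_nat n \<in> F" for n
    by (induction n) (auto intro: subfield_closed[OF F])
  show ?thesis
    by (cases k) (auto intro!: nat subfield_closed[OF F] simp del: of_nat_Suc)
qed

lemma Rats_subset_subfield: "\<rat> \<subseteq> F" if F: "is_subfield F"
proof
  fix q :: 'a assume "q \<in> \<rat>"
  then obtain a b :: int where "q = of_int a / of_int b"
    by (elim Rats_cases') auto
  then show "q \<in> F"
    by (auto intro: subfield_divide[OF F] subfield_of_int[OF F])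
qed

lemma is_subfield_Rats: "is_subfield \<rat>"
  by (auto simp: is_subfield_def)

lemma is_subfield_Int: "is_subfield F \<Longrightarrow> is_subfield G \<Longrightarrow> is_subfield (F \<inter> G)"
  by (auto simp: is_subfield_def)

lemma adjoinI: "a \<in> F \<Longrightarrow> b \<in> F \<Longrightarrow> a + b * y \<in> adjoin F y"
  by (auto simp: adjoin_def)

lemma adjoinE:
  assumes "z \<in> adjoin F y"
  obtains a b where "a \<in> F" "b \<in> F" "z = a + b * y"
  using assms by (auto simp: adjoin_def)

lemma subset_adjoin: "is_subfield F \<Longrightarrow> F \<subseteq> adjoin F y"
  using adjoinI[of _ F 0 y] subfield_0 by fastforce

lemma mem_adjoin: "is_subfield F \<Longrightarrow> y \<in> adjoin F y"
  using adjoinI[of 0 F 1 y] subfield_0 subfield_1 by fastforce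

lemma adjoin_subset: "is_subfield G \<Longrightarrow> F \<subseteq> G \<Longrightarrow> y \<in> G \<Longrightarrow> adjoin F y \<subseteq> G"
  by (auto simp: adjoin_def intro!: subfield_add subfield_mult)

lemma adjoin_absorb: "is_subfield F \<Longrightarrow> y \<in> F \<Longrightarrow> adjoin F y = F"
  by (simp add: adjoin_subset subset_adjoin subset_antisym)

lemma adjoin_mult_generator:
  assumes F: "is_subfield F" and "b \<in> F" "b \<noteq> 0"
  shows "adjoin F (b * y) = adjoin F y"
proof -
  have le: "adjoin F (c * w) \<subseteq> adjoin F w" if "c \<in> F" for c w
    using that by (auto simp: adjoin_def mult.assoc[symmetric] intro: subfield_mult[OF F])
  have "adjoin F (inverse b * (b * y)) \<subseteq> adjoin F (b * y)"
    by (rule le) (simp add: assms subfield_inverse)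
  then have "adjoin F y \<subseteq> adjoin F (b * y)"
    using \<open>b \<noteq> 0\<close> by (simp add: mult.assoc[symmetric])
  with le[OF \<open>b \<in> F\<close>] show ?thesis by blast
qed

lemma adjoin_unique:
  assumes F: "is_subfield F" and y: "y \<notin> F"
    and abcd: "a \<in> F" "b \<in> F" "c \<in> F" "d \<in> F" and eq: "a + b * y = c + d * y"
  shows "a = c" "b = d"
proof -
  show "b = d"
  proof (rule ccontr)
    assume "b \<noteq> d"
    then have "y = (c - a) / (b - d)"
      using eq by (simp add: field_simps)
    with y abcd show False
      by (auto intro: subfield_divide[OF F] subfield_diff[OF F])
  qed
  with eq show "a = c" by simp
qed

lemma is_subfield_adjoin:
  assumes F: "is_subfield F" and y2: "y\<^sup>2 \<in> F"
  shows "is_subfield (adjoin F y)"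
proof (cases "y \<in> F")
  case True
  then show ?thesis using F adjoin_absorb by metis
next
  case False
  note cl = subfield_closed[OF F]
  have "z - w \<in> adjoin F y" if "z \<in> adjoin F y" "w \<in> adjoin F y" for z w
  proof -
    obtain a b c d where *: "a \<in> F" "b \<in> F" "c \<in> F" "d \<in> F" "z = a + b * y" "w = c + d * y"
      using \<open>z \<in> _\<close> \<open>w \<in> _\<close> by (auto elim!: adjoinE)
    then have "z - w = (a - c) + (b - d) * y" by (simp add: algebra_simps)
    with * show ?thesis by (metis adjoinI cl(3))
  qed
  moreover have "z * w \<in> adjoin F y" if "z \<in> adjoin F y" "w \<in> adjoin F y" for z w
  proof -
    obtain a b c d where *: "a \<in> F" "b \<in> F" "c \<in> F" "d \<in> F" "z = a + b * y" "w = c + d * y"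
      using \<open>z \<in> _\<close> \<open>w \<in> _\<close> by (auto elim!: adjoinE)
    then have "z * w = (a * c + b * d * y\<^sup>2) + (a * d + b * c) * y"
      by (simp add: algebra_simps power2_eq_square)
    moreover have "a * c + b * d * y\<^sup>2 \<in> F" "a * d + b * c \<in> F"
      using * y2 by (auto intro!: cl)
    ultimately show ?thesis by (metis adjoinI)
  qed
  moreover have "inverse z \<in> adjoin F y" if "z \<in> adjoin F y" for z
  proof (cases "z = 0")
    case True
    then show ?thesis using subset_adjoin[OF F] cl(2) by auto
  next
    case nz: False
    obtain a b where ab: "a \<in> F" "b \<in> F" "z = a + b * y"
      using \<open>z \<in> _\<close> by (auto elim: adjoinE)
    define n where "n = a\<^sup>2 - b\<^sup>2 * y\<^sup>2"
    have n: "n = z * (a - b * y)"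
      by (simp add: n_def ab algebra_simps power2_eq_square)
    have "a - b * y \<noteq> 0"
    proof
      assume "a - b * y = 0"
      then have "a + (- b) * y = 0 + 0 * y" by simp
      then have "a = 0" "- b = 0"
        using adjoin_unique[OF F False ab(1) cl(4)[OF ab(2)] cl(2) cl(2)] by blast+
      with ab nz show False by simp
    qed
    then have "inverse z = (a - b * y) / n"
      by (simp add: n inverse_eq_divide)
    then have "inverse z = a / n + (- b / n) * y"
      by (simp add: diff_divide_distrib)
    moreover have "n \<in> F" using ab y2 by (auto simp: n_def intro!: cl)
    ultimately show ?thesis using ab by (metis adjoinI cl(4) cl(8))
  qed
  moreover have "1 \<in> adjoin F y"
    using subset_adjoin[OF F] cl(1) by auto
  ultimately show ?thesis by (simp add: is_subfield_def)
qed

text \<open>The witness is the norm of \<open>z\<close> from \<open>F(y)\<close> to \<open>F\<close>.\<close>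

lemma square_norm_is_square:
  assumes F: "is_subfield F" and y: "y \<notin> F" "y\<^sup>2 \<in> F"
    and z: "z \<in> adjoin F y" and uv: "u \<in> F" "v \<in> F" "z\<^sup>2 = u + v * y"
  shows "\<exists>p\<in>F. p\<^sup>2 = u\<^sup>2 - v\<^sup>2 * y\<^sup>2"
proof -
  note cl = subfield_closed[OF F]
  obtain a b where ab: "a \<in> F" "b \<in> F" "z = a + b * y"
    using z by (auto elim: adjoinE)
  have in_F: "a\<^sup>2 + b\<^sup>2 * y\<^sup>2 \<in> F" "a * b + a * b \<in> F" "a\<^sup>2 - b\<^sup>2 * y\<^sup>2 \<in> F"
    using ab y by (simp_all only: cl)
  have "(a\<^sup>2 + b\<^sup>2 * y\<^sup>2) + (a * b + a * b) * y = u + v * y"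
    using uv(3) ab(3) by (simp add: algebra_simps power2_eq_square)
  from adjoin_unique[OF F y(1) in_F(1,2) uv(1,2) this]
  have "(a\<^sup>2 - b\<^sup>2 * y\<^sup>2)\<^sup>2 = u\<^sup>2 - v\<^sup>2 * y\<^sup>2"
    by (auto simp: algebra_simps power2_eq_square)
  with in_F(3) show ?thesis by blast
qed

text \<open>The coefficient of \<open>y\<close> in the square of \<open>a + b * y\<close> is
  \<open>2 * a * b\<close>, which has to vanish; \<open>b\<close> is nonzero because
  \<open>z\<close> is not in \<open>F\<close>, so \<open>a = 0\<close>.\<close>

lemma adjoin_square_in_base:
  assumes F: "is_subfield F" and y: "y \<notin> F" "y\<^sup>2 \<in> F"
    and z: "z \<in> adjoin F y" "z\<^sup>2 \<in> F" "z \<notin> F"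
  obtains b where "b \<in> F" "b \<noteq> 0" "z = b * y"
proof -
  note cl = subfield_closed[OF F]
  obtain a b where ab: "a \<in> F" "b \<in> F" "z = a + b * y"
    using z by (auto elim: adjoinE)
  have in_F: "a\<^sup>2 + b\<^sup>2 * y\<^sup>2 \<in> F" "a * b + a * b \<in> F"
    using ab y by (simp_all only: cl)
  have "(a\<^sup>2 + b\<^sup>2 * y\<^sup>2) + (a * b + a * b) * y = z\<^sup>2 + 0 * y"
    using ab(3) by (simp add: algebra_simps power2_eq_square)
  from adjoin_unique(2)[OF F y(1) in_F(1,2) z(2) cl(2) this]
  have "a * b = 0" by (simp flip: mult_2)
  moreover have "b \<noteq> 0" using ab z(3) by auto
  ultimately show ?thesis using that[of b] ab by auto
qed

section \<open>Embeddings\<close>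

definition field_hom_on :: "'a::field_char_0 set \<Rightarrow> ('a \<Rightarrow> 'b::field_char_0) \<Rightarrow> bool" where
  "field_hom_on F f \<longleftrightarrow> f 1 = 1 \<and> (\<forall>a\<in>F. \<forall>b\<in>F. f (a + b) = f a + f b \<and> f (a * b) = f a * f b)"

lemma field_hom_on_of_int:
  assumes F: "is_subfield F" and f: "field_hom_on F f"
  shows "f (of_int k) = of_int k"
proof -
  note cl = subfield_closed[OF F]
  have add: "f (a + b) = f a + f b" if "a \<in> F" "b \<in> F" for a b
    using f that by (auto simp: field_hom_on_def)
  have 1: "f 1 = 1" using f by (simp add: field_hom_on_def)
  have 0: "f 0 = 0" using add[OF cl(2) cl(2)] by simp
  have in_F: "of_nat n \<in> F" for n
    using subfield_of_int[OF F, of "int n"] by simp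
  have nat: "f (of_nat n) = of_nat n" for n
    by (induction n) (simp_all add: 0 1 add[OF cl(1) in_F])
  have "f (- of_nat n) = - of_nat n" for n
    using add[OF in_F[of n] cl(4)[OF in_F[of n]]] by (simp add: 0 nat eq_neg_iff_add_eq_0 add.commute)
  then show ?thesis
    by (cases k) (simp_all only: nat of_int_minus of_int_of_nat_eq)
qed

text \<open>Unique coordinates make \<open>a + b * y\<close> to \<open>f a + f b * w\<close> well
  defined, and products are respected because \<open>w\<close> is a square root of the image of the
  square of \<open>y\<close>. Either root may be taken, which later allows free choice of
  signs.\<close>

lemma field_hom_extend:
  assumes F: "is_subfield F" and f: "field_hom_on F f" and y: "y \<notin> F" "y\<^sup>2 \<in> F"
    and w: "w\<^sup>2 = f (y\<^sup>2)"
  obtains g where "field_hom_on (adjoin F y) g" "\<And>a. a \<in> F \<Longrightarrow> g a = f a" "g y = w"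
proof -
  note cl = subfield_closed[OF F]
  have add: "f (a + b) = f a + f b" and mult: "f (a * b) = f a * f b" if "a \<in> F" "b \<in> F" for a b
    using f that by (auto simp: field_hom_on_def)
  have f1: "f 1 = 1" using f by (simp add: field_hom_on_def)
  have f0: "f 0 = 0" using add[OF cl(2) cl(2)] by simp
  define g where "g z = (THE r. \<exists>a\<in>F. \<exists>b\<in>F. z = a + b * y \<and> r = f a + f b * w)" for z
  have g: "g (a + b * y) = f a + f b * w" if "a \<in> F" "b \<in> F" for a b
    unfolding g_def
  proof (rule the_equality)
    fix r assume "\<exists>a'\<in>F. \<exists>b'\<in>F. a + b * y = a' + b' * y \<and> r = f a' + f b' * w"
    then show "r = f a + f b * w"
      using adjoin_unique[OF F y(1) that] by metis
  qed (use that in blast)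
  have g_F: "g a = f a" if "a \<in> F" for a
    using g[OF that cl(2)] by (simp add: f0)
  have "g (z + z') = g z + g z' \<and> g (z * z') = g z * g z'"
    if "z \<in> adjoin F y" "z' \<in> adjoin F y" for z z'
  proof -
    obtain a b c d where *: "a \<in> F" "b \<in> F" "c \<in> F" "d \<in> F" "z = a + b * y" "z' = c + d * y"
      using \<open>z \<in> _\<close> \<open>z' \<in> _\<close> by (auto elim!: adjoinE)
    have "z + z' = (a + c) + (b + d) * y"
      using * by (simp add: algebra_simps)
    then have "g (z + z') = f (a + c) + f (b + d) * w"
      using * by (metis g cl(5))
    moreover have "z * z' = (a * c + b * d * y\<^sup>2) + (a * d + b * c) * y"
      using * by (simp add: algebra_simps power2_eq_square)
    then have "g (z * z') = f (a * c + b * d * y\<^sup>2) + f (a * d + b * c) * w"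
      using * y by (metis g cl(5) cl(6))
    moreover have "f (a * c + b * d * y\<^sup>2) = f a * f c + f b * f d * w\<^sup>2"
      "f (a * d + b * c) = f a * f d + f b * f c"
      using * y w by (simp_all add: add mult cl)
    ultimately show ?thesis
      using * by (simp add: g add algebra_simps power2_eq_square)
  qed
  then have "field_hom_on (adjoin F y) g"
    by (simp add: field_hom_on_def g_F cl f1)
  moreover have "g y = w"
    using g[OF cl(2) cl(1)] by (simp add: f0 f1)
  ultimately show ?thesis using g_F that by blast
qed


section \<open>Towers of nested square roots\<close>

text \<open>The degree condition enters as \<open>x_notin\<close>; with \<open>K_Suc\<close> each
  level then has coordinates \<open>a + b * x (Suc n)\<close> over the previous one.\<close>

locale sqrt_tower =
  fixes \<nu> x0 :: int and x :: "nat \<Rightarrow> 'a::field_char_0" and K :: "nat \<Rightarrow> 'a set"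
  assumes x_0: "x 0 = of_int x0"
    and x_Suc: "(x (Suc n))\<^sup>2 = of_int \<nu> + x n"
    and K_0: "K 0 = \<rat>"
    and K_Suc: "K (Suc n) = adjoin (K n) (x (Suc n))"
    and x_notin: "x (Suc n) \<notin> K n"
begin

lemma K_props: "is_subfield (K n) \<and> x n \<in> K n"
proof (induction n)
  case 0
  show ?case by (simp add: K_0 x_0 is_subfield_Rats)
next
  case (Suc n)
  then have "(x (Suc n))\<^sup>2 \<in> K n"
    by (simp add: x_Suc subfield_add subfield_of_int)
  with Suc show ?case
    by (simp add: K_Suc is_subfield_adjoin mem_adjoin)
qed

lemma is_subfield_K: "is_subfield (K n)" and x_in_K: "x n \<in> K n"
  using K_props by auto

lemma x_Suc_square_in_K: "(x (Suc n))\<^sup>2 \<in> K n"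
  by (simp add: x_Suc subfield_add subfield_of_int is_subfield_K x_in_K)

lemma K_mono: "m \<le> n \<Longrightarrow> K m \<subseteq> K n"
  by (rule lift_Suc_mono_le) (auto simp: K_Suc subset_adjoin[OF is_subfield_K, THEN subsetD])

lemma square_in_K_Suc:
  assumes "z \<in> K (Suc n)" "z\<^sup>2 = u + v * x (Suc n)" "u \<in> K n" "v \<in> K n"
  shows "\<exists>p\<in>K n. p\<^sup>2 = u\<^sup>2 - v\<^sup>2 * (of_int \<nu> + x n)"
  using square_norm_is_square[OF is_subfield_K x_notin x_Suc_square_in_K, of z n u v] assms
  by (simp add: K_Suc x_Suc)

text \<open>The right-hand side is the norm of \<open>of_int \<nu> + x (Suc i)\<close> from
  \<open>K (Suc i)\<close> to \<open>K i\<close>. This condition will imply thinness from level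
  \<open>m\<close> on.\<close>

definition nonsquare_from :: "nat \<Rightarrow> bool" where
  "nonsquare_from m \<longleftrightarrow> (\<forall>i\<ge>m. \<forall>p\<in>K i. p\<^sup>2 \<noteq> of_int (\<nu>\<^sup>2 - \<nu>) - x i)"

text \<open>
  If \<open>p = b x\<^sub>i\<^sub>+\<^sub>2\<close> with \<open>b \<in> K\<^sub>i\<^sub>+\<^sub>1\<close> and \<open>d = p\<^sup>2 \<in> K\<^sub>i\<close>, then \<open>d (\<nu> + x\<^sub>i\<^sub>+\<^sub>1)\<close> is a square
  in \<open>K\<^sub>i\<^sub>+\<^sub>1\<close>, and its norm is \<open>d\<^sup>2 (\<nu>\<^sup>2 - \<nu> - x\<^sub>i)\<close>.
\<close>

lemma sqrt_in_next_level:
  assumes ns: "nonsquare_from m" and "m \<le> j" "j \<le> n" and p: "p \<in> K n" "p\<^sup>2 \<in> K j"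
  shows "p \<in> K (Suc j)"
  using \<open>j \<le> n\<close> p(1)
proof (induction n rule: less_induct)
  case (less n)
  show ?case
  proof (cases "n \<le> Suc j")
    case True
    with less.prems show ?thesis using K_mono by blast
  next
    case False
    \<comment> \<open>Descent by one level: either \<open>p\<close> already lies in
      \<open>K (Suc i)\<close>, or a forbidden square appears in \<open>K i\<close>.\<close>
    define i where "i = n - 2"
    have n: "n = Suc (Suc i)" and ij: "j \<le> i" using False by (auto simp: i_def)
    have p2: "p\<^sup>2 \<in> K i" "p\<^sup>2 \<in> K (Suc i)"
      using p(2) K_mono ij le_SucI by blast+
    show ?thesis
    proof (cases "p \<in> K (Suc i)")
      case True
      then show ?thesis using less.IH[of "Suc i"] n ij by simp
    next
      case notin: False
      have "p \<in> adjoin (K (Suc i)) (x (Suc (Suc i)))"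
        using less.prems by (simp add: n K_Suc)
      then obtain b where b: "b \<in> K (Suc i)" "b \<noteq> 0" "p = b * x (Suc (Suc i))"
        using adjoin_square_in_base[OF is_subfield_K x_notin x_Suc_square_in_K _ p2(2) notin] by blast
      have p_b: "p\<^sup>2 = b\<^sup>2 * (of_int \<nu> + x (Suc i))"
        using b(3) by (simp add: power_mult_distrib x_Suc)
      have "(p\<^sup>2 / b)\<^sup>2 = p\<^sup>2 * (p\<^sup>2 / b\<^sup>2)"
        by (simp add: power2_eq_square)
      also have "p\<^sup>2 / b\<^sup>2 = of_int \<nu> + x (Suc i)"
        using b(2) by (simp add: p_b)
      finally have sq: "(p\<^sup>2 / b)\<^sup>2 = p\<^sup>2 * of_int \<nu> + p\<^sup>2 * x (Suc i)"
        by (simp add: algebra_simps)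
      have "p\<^sup>2 / b \<in> K (Suc i)" "p\<^sup>2 * of_int \<nu> \<in> K i"
        using b p2 by (auto intro!: subfield_divide subfield_mult subfield_of_int is_subfield_K)
      from square_in_K_Suc[OF this(1) sq this(2) p2(1)]
      obtain q where q: "q \<in> K i" "q\<^sup>2 = (p\<^sup>2 * of_int \<nu>)\<^sup>2 - (p\<^sup>2)\<^sup>2 * (of_int \<nu> + x i)"
        by blast
      have "p \<noteq> 0" using notin subfield_0[OF is_subfield_K] by auto
      have "q\<^sup>2 = (p\<^sup>2)\<^sup>2 * (of_int (\<nu>\<^sup>2 - \<nu>) - x i)"
        using q(2) by (simp add: algebra_simps power2_eq_square)
      then have "(q / p\<^sup>2)\<^sup>2 = of_int (\<nu>\<^sup>2 - \<nu>) - x i"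
        using \<open>p \<noteq> 0\<close> by (simp add: power_divide)
      moreover have "q / p\<^sup>2 \<in> K i"
        by (intro subfield_divide is_subfield_K q p2)
      moreover have "m \<le> i" using \<open>m \<le> j\<close> ij by simp
      ultimately show ?thesis using ns by (auto simp: nonsquare_from_def)
    qed
  qed
qed

lemma no_other_index_two_subfield:
  assumes ns: "nonsquare_from m" and "m \<le> j" "j < n"
    and M: "is_subfield M" "M \<inter> K n = K j"
    and y: "y\<^sup>2 \<in> M" "adjoin M y = K (Suc n)"
  shows False
proof -
  have Kj: "K j \<subseteq> M" using M(2) by blast
  have xj: "x (Suc j) \<in> K n" using x_in_K K_mono[of "Suc j" n] \<open>j < n\<close> by auto
  have xj_M: "x (Suc j) \<notin> M" using M(2) xj x_notin by blast
  then have y_M: "y \<notin> M"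
    using adjoin_absorb[OF M(1), of y] y(2) xj K_mono[of n "Suc n"] by auto
  have xj_adj: "x (Suc j) \<in> adjoin M y" using y(2) xj K_mono[of n "Suc n"] by auto
  have "(x (Suc j))\<^sup>2 \<in> M" using x_Suc_square_in_K Kj by blast
  from adjoin_square_in_base[OF M(1) y_M y(1) xj_adj this xj_M]
  obtain b where "b \<in> M" "b \<noteq> 0" "x (Suc j) = b * y" by blast
  then have adj: "adjoin M (x (Suc j)) = K (Suc n)"
    using adjoin_mult_generator[OF M(1)] y(2) by simp
  have "x (Suc (Suc j)) \<in> adjoin M (x (Suc j))"
    using x_in_K K_mono[of "Suc (Suc j)" "Suc n"] \<open>j < n\<close> adj by auto
  moreover have "(x (Suc (Suc j)))\<^sup>2 = of_int \<nu> + 1 * x (Suc j)" by (simp add: x_Suc)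
  ultimately obtain p where p: "p \<in> M" "p\<^sup>2 = (of_int \<nu>)\<^sup>2 - 1\<^sup>2 * (x (Suc j))\<^sup>2"
    using square_norm_is_square[OF M(1) xj_M \<open>(x (Suc j))\<^sup>2 \<in> M\<close>]
      subfield_of_int[OF M(1)] subfield_1[OF M(1)] by blast
  then have p2: "p\<^sup>2 = of_int (\<nu>\<^sup>2 - \<nu>) - x j" by (simp add: x_Suc)
  then have "p\<^sup>2 \<in> K j"
    by (simp only:) (intro subfield_diff subfield_of_int is_subfield_K x_in_K)
  moreover have "p \<in> K (Suc n)" using p(1) subset_adjoin[OF M(1)] adj by blast
  \<comment> \<open>Since \<open>j < n\<close>, this places \<open>p\<close> in \<open>K n\<close>
    as well as in \<open>M\<close>, hence in their intersection \<open>K j\<close>.\<close>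
  ultimately have "p \<in> K (Suc j)"
    using sqrt_in_next_level[OF ns \<open>m \<le> j\<close>, of "Suc n" p] \<open>j < n\<close> by simp
  then have "p \<in> K j"
    using p(1) M(2) K_mono[of "Suc j" n] \<open>j < n\<close> by auto
  with ns p2 \<open>m \<le> j\<close> show False by (auto simp: nonsquare_from_def)
qed

text \<open>
  Adjoining \<open>x\<^sub>m\<^sub>+\<^sub>1, x\<^sub>m\<^sub>+\<^sub>2, \<dots>\<close> to \<open>L\<close> one after the other reaches \<open>K\<^sub>n\<close> by steps of degree at most
  two, so a proper subfield \<open>L\<close> lies in a subfield of index two.
\<close>

lemma contained_in_index_two:
  assumes L: "is_subfield L" "K m \<subseteq> L" "L \<subset> K n" and "m \<le> n"
  obtains M y where "is_subfield M" "L \<subseteq> M" "M \<noteq> K n" "y\<^sup>2 \<in> M" "adjoin M y = K n"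
proof -
  define C where "C = rec_nat L (\<lambda>i F. adjoin F (x (Suc (m + i))))"
  have C_0: "C 0 = L" and C_Suc: "C (Suc i) = adjoin (C i) (x (Suc (m + i)))" for i
    by (simp_all add: C_def)
  have C: "is_subfield (C i) \<and> L \<subseteq> C i \<and> K (m + i) \<subseteq> C i" for i
  proof (induction i)
    case 0
    then show ?case using L by (simp add: C_0)
  next
    case (Suc i)
    then have F: "is_subfield (C (Suc i))"
      using x_Suc_square_in_K[of "m + i"] by (auto simp: C_Suc intro!: is_subfield_adjoin)
    moreover have le: "C i \<subseteq> C (Suc i)" using Suc by (simp add: C_Suc subset_adjoin)
    moreover have "K (m + Suc i) \<subseteq> C (Suc i)"
      using adjoin_subset[OF F, of "K (m + i)" "x (Suc (m + i))"] Suc le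
      by (auto simp: K_Suc C_Suc mem_adjoin)
    ultimately show ?case using Suc by blast
  qed
  have C_le: "C i \<subseteq> K n" if "m + i \<le> n" for i
    using that
  proof (induction i)
    case 0
    then show ?case using L by (auto simp: C_0)
  next
    case (Suc i)
    then show ?case
      using adjoin_subset[OF is_subfield_K[of n], of "C i" "x (Suc (m + i))"]
        x_in_K[of "Suc (m + i)"] K_mono[of "Suc (m + i)" n] by (auto simp: C_Suc)
  qed
  define i where "i = (LEAST i. C i = K n)"
  have i: "C i = K n"
    unfolding i_def
  proof (rule LeastI)
    show "C (n - m) = K n" using C_le[of "n - m"] C[of "n - m"] \<open>m \<le> n\<close> by auto
  qed
  then have "i \<noteq> 0" using L C_0 by (metis psubset_eq)
  then obtain k where k: "i = Suc k" by (cases i) auto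
  have "C k \<noteq> K n" using not_less_Least[of k "\<lambda>i. C i = K n"] k i_def by auto
  moreover have "(x (Suc (m + k)))\<^sup>2 \<in> C k" using x_Suc_square_in_K C by blast
  ultimately show ?thesis
    using that[of "C k"] C[of k] i k C_Suc by auto
qed

text \<open>Induction on \<open>n\<close>. A proper \<open>L\<close> lies in some \<open>M\<close>
  of index two, and by induction \<open>M \<inter> K n\<close> is some \<open>K j\<close>. The case
  \<open>j < n\<close> is excluded by \<open>no_other_index_two_subfield\<close>, and
  \<open>j = n\<close> forces \<open>M = K n\<close>, so the induction hypothesis applies to
  \<open>L\<close>.\<close>

theorem intermediate_field:
  assumes ns: "nonsquare_from m" and "m \<le> n" and L: "is_subfield L" "K m \<subseteq> L" "L \<subseteq> K n"
  shows "\<exists>j. m \<le> j \<and> j \<le> n \<and> L = K j"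
  using \<open>m \<le> n\<close> L
proof (induction n arbitrary: L rule: dec_induct)
  case base
  then show ?case by auto
next
  case (step n)
  show ?case
  proof (cases "L = K (Suc n)")
    case True
    then show ?thesis using step.hyps le_Suc_eq by blast
  next
    case False
    then obtain M y where M: "is_subfield M" "L \<subseteq> M" "M \<noteq> K (Suc n)" "y\<^sup>2 \<in> M" "adjoin M y = K (Suc n)"
      using contained_in_index_two[of L m "Suc n"] step by (metis le_SucI psubsetI)
    have "is_subfield (M \<inter> K n)" "K m \<subseteq> M \<inter> K n" "M \<inter> K n \<subseteq> K n"
      using M step K_mono[OF step.hyps(1)] by (auto intro: is_subfield_Int is_subfield_K)
    then obtain j where j: "m \<le> j" "j \<le> n" "M \<inter> K n = K j"
      using step.IH by blast
    have "j = n"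
      using no_other_index_two_subfield[OF ns j(1) _ M(1) j(3) M(4,5)] j(2) by fastforce
    then have "K n \<subseteq> M" using j(3) by blast
    \<comment> \<open>An element of \<open>M\<close> outside \<open>K n\<close> can be solved for
      \<open>x (Suc n)\<close>, which would make \<open>M\<close> all of
      \<open>K (Suc n)\<close>.\<close>
    have "M \<subseteq> K n"
    proof (rule ccontr)
      assume "\<not> M \<subseteq> K n"
      then obtain z where z: "z \<in> M" "z \<notin> K n" by blast
      have "z \<in> adjoin (K n) (x (Suc n))"
        using z(1) M(5) subset_adjoin[OF M(1)] by (auto simp: K_Suc)
      then obtain a b where ab: "a \<in> K n" "b \<in> K n" "z = a + b * x (Suc n)"
        by (auto elim: adjoinE)
      with z have "b \<noteq> 0" by auto
      then have "x (Suc n) = (z - a) / b" by (simp add: ab)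
      moreover have "(z - a) / b \<in> M"
        using z ab \<open>K n \<subseteq> M\<close> by (intro subfield_divide subfield_diff M(1)) auto
      ultimately have "x (Suc n) \<in> M" by simp
      then have "K (Suc n) \<subseteq> M"
        using adjoin_subset[OF M(1) \<open>K n \<subseteq> M\<close>] by (simp add: K_Suc)
      then show False using M(3,5) subset_adjoin[OF M(1)] by blast
    qed
    then show ?thesis using step.IH[of L] step.prems M(2) by (meson le_SucI subset_trans)
  qed
qed

section \<open>Squares among the elements u0 - x_n\<close>

text \<open>
  For \<open>\<nu> = 2\<close> the norm of \<open>2 - x\<^sub>n\<close> is \<open>2 - x\<^sub>n\<^sub>-\<^sub>1 = (2 - x\<^sub>n) (2 + x\<^sub>n)\<close>, so if \<open>2 - x\<^sub>n\<close> is a square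
  then so is \<open>2 + x\<^sub>n = x\<^sub>n\<^sub>+\<^sub>1\<^sup>2\<close>.
\<close>

lemma nonsquare_two:
  assumes "\<nu> = 2" "p \<in> K (Suc n)"
  shows "p\<^sup>2 \<noteq> 2 - x (Suc n)"
proof
  assume p: "p\<^sup>2 = 2 - x (Suc n)"
  then have "p\<^sup>2 = of_int 2 + of_int (- 1) * x (Suc n)" by simp
  from square_in_K_Suc[OF assms(2) this] obtain q
    where q: "q \<in> K n" "q\<^sup>2 = (of_int 2)\<^sup>2 - (of_int (- 1))\<^sup>2 * (of_int \<nu> + x n)"
    using subfield_of_int[OF is_subfield_K] by blast
  have "q\<^sup>2 = 2\<^sup>2 - (x (Suc n))\<^sup>2"
    by (simp add: q(2) x_Suc)
  also have "\<dots> = p\<^sup>2 * (2 + x (Suc n))"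
    unfolding p by (simp add: algebra_simps power2_eq_square)
  also have "2 + x (Suc n) = (x (Suc (Suc n)))\<^sup>2" by (simp add: x_Suc assms)
  finally have "(q / p)\<^sup>2 = (x (Suc (Suc n)))\<^sup>2"
    if "p \<noteq> 0" using that by (simp add: power_divide)
  moreover have "p \<noteq> 0"
  proof
    assume "p = 0"
    with p have "x (Suc n) = of_int 2" by simp
    then show False using x_notin[of n] subfield_of_int[OF is_subfield_K, of 2 n] by simp
  qed
  ultimately have "x (Suc (Suc n)) = q / p \<or> x (Suc (Suc n)) = - (q / p)"
    by (metis power2_eq_iff)
  moreover have "q / p \<in> K (Suc n)"
    using q(1) K_mono[of n "Suc n"] assms(2) by (auto intro!: subfield_divide is_subfield_K)
  ultimately show False
    using x_notin[of "Suc n"] subfield_minus[OF is_subfield_K] by metis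
qed

end

lemma rat_square_int:
  assumes "q \<in> \<rat>" "q\<^sup>2 = (of_int m :: 'a::field_char_0)"
  shows "\<exists>k::int. k\<^sup>2 = m"
proof -
  obtain a b :: int where ab: "b > 0" "coprime a b" "q = of_int a / of_int b"
    using assms(1) by (auto elim!: Rats_cases')
  then have "of_int a = q * of_int b" by simp
  then have "of_int (a\<^sup>2) = (of_int (m * b\<^sup>2) :: 'a)"
    using assms(2) by (simp add: power_mult_distrib)
  then have "a\<^sup>2 = m * b\<^sup>2" by (simp only: of_int_eq_iff)
  then have "b\<^sup>2 dvd a\<^sup>2" by simp
  moreover have "coprime (a\<^sup>2) (b\<^sup>2)" using ab by simp
  ultimately have "b\<^sup>2 = 1"
    using ab(1) coprime_common_divisor[of "a\<^sup>2" "b\<^sup>2" "b\<^sup>2"] by simp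
  with \<open>a\<^sup>2 = m * b\<^sup>2\<close> show ?thesis by auto
qed

lemma between_squares:
  fixes u k d :: int
  assumes "u \<ge> 1" "0 < d" "d < 2 * u - 1"
  shows "k\<^sup>2 \<noteq> u\<^sup>2 - d"
proof
  assume k: "k\<^sup>2 = u\<^sup>2 - d"
  then have "\<bar>k\<bar>\<^sup>2 < u\<^sup>2" using assms by simp
  then have "\<bar>k\<bar> < u" using assms by (meson power_less_imp_less_base order.trans zero_le_one)
  then have "\<bar>k\<bar>\<^sup>2 \<le> (u - 1)\<^sup>2" by (intro power_mono) auto
  then show False using k assms by (simp add: algebra_simps power2_eq_square)
qed

text \<open>
  Iterated norms of \<open>u\<^sub>0 - x\<^sub>n\<close>: with \<open>u\<^sub>i\<^sub>+\<^sub>1 = u\<^sub>i\<^sup>2 - \<nu>\<close>, the norm of \<open>u\<^sub>i - x\<^sub>n\<close> is \<open>u\<^sub>i\<^sub>+\<^sub>1 - x\<^sub>n\<^sub>-\<^sub>1\<close>.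
\<close>

lemma (in sqrt_tower) nonsquare_large:
  assumes \<nu>: "\<nu> \<ge> 3" and x0: "0 \<le> x0" "x0 \<le> \<nu>\<^sup>2 - \<nu>"
    and "u \<ge> \<nu>\<^sup>2 - \<nu>" "p \<in> K (Suc n)"
  shows "p\<^sup>2 \<noteq> of_int u - x (Suc n)"
  using assms(4,5)
proof (induction n arbitrary: u p)
  case (0 u p)
  show ?case
  proof
    assume "p\<^sup>2 = of_int u - x (Suc 0)"
    then have "p\<^sup>2 = of_int u + of_int (- 1) * x (Suc 0)" by simp
    from square_in_K_Suc[OF 0(2) this] obtain q
      where q: "q \<in> K 0" "q\<^sup>2 = (of_int u)\<^sup>2 - (of_int (- 1))\<^sup>2 * (of_int \<nu> + x 0)"
      using subfield_of_int[OF is_subfield_K] by blast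
    then have "q\<^sup>2 = of_int (u\<^sup>2 - (\<nu> + x0))" by (simp add: x_0)
    with q(1) obtain k :: int where k: "k\<^sup>2 = u\<^sup>2 - (\<nu> + x0)"
      using rat_square_int K_0 by metis
    \<comment> \<open>Here \<nu> \<ge> 3 enters: it gives u \<ge> 2 \<nu>, so \<nu> < u - 1, and x0
      \<le> u holds by the bound on x0.\<close>
    have "\<nu> * \<nu> \<ge> 3 * \<nu>" using \<nu> by (intro mult_right_mono) auto
    then have "u \<ge> 1" "0 < \<nu> + x0" "\<nu> + x0 < 2 * u - 1"
      using \<nu> x0 0(1) unfolding power2_eq_square by linarith+
    from between_squares[OF this] k show False by blast
  qed
next
  case (Suc n u p)
  have "\<nu> * \<nu> \<ge> 3 * \<nu>" using \<nu> by (intro mult_right_mono) auto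
  then have "\<nu> \<le> u" using Suc.prems(1) \<nu> unfolding power2_eq_square by linarith
  then have u': "u\<^sup>2 - \<nu> \<ge> \<nu>\<^sup>2 - \<nu>"
    using \<nu> by (simp add: power_mono)
  show ?case
  proof
    assume "p\<^sup>2 = of_int u - x (Suc (Suc n))"
    then have "p\<^sup>2 = of_int u + of_int (- 1) * x (Suc (Suc n))" by simp
    from square_in_K_Suc[OF Suc.prems(2) this] obtain q
      where q: "q \<in> K (Suc n)" "q\<^sup>2 = (of_int u)\<^sup>2 - (of_int (- 1))\<^sup>2 * (of_int \<nu> + x (Suc n))"
      using subfield_of_int[OF is_subfield_K] by blast
    then have "q\<^sup>2 = of_int (u\<^sup>2 - \<nu>) - x (Suc n)" by simp
    with Suc.IH[OF u' q(1)] show False by blast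
  qed
qed

lemma (in sqrt_tower) nonsquare_from_1:
  assumes "\<nu> \<ge> 2" "0 \<le> x0" "x0 \<le> \<nu>\<^sup>2 - \<nu>"
  shows "nonsquare_from 1"
  unfolding nonsquare_from_def
proof (intro allI ballI impI)
  fix i p assume "1 \<le> i" "p \<in> K i"
  then obtain n where "i = Suc n" "p \<in> K (Suc n)" by (cases i) auto
  then show "p\<^sup>2 \<noteq> of_int (\<nu>\<^sup>2 - \<nu>) - x i"
    using assms nonsquare_two[of p n] nonsquare_large[of "\<nu>\<^sup>2 - \<nu>" p n] by (cases "\<nu> = 2") auto
qed

lemma (in sqrt_tower) nonsquare_from_0_iff:
  assumes "\<nu> \<ge> 2" "0 \<le> x0" "x0 \<le> \<nu>\<^sup>2 - \<nu>"
  shows "nonsquare_from 0 \<longleftrightarrow> \<not> (\<exists>k::int. \<nu>\<^sup>2 - \<nu> - x0 = k\<^sup>2)"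
proof
  assume ns: "nonsquare_from 0"
  show "\<not> (\<exists>k::int. \<nu>\<^sup>2 - \<nu> - x0 = k\<^sup>2)"
  proof
    assume "\<exists>k::int. \<nu>\<^sup>2 - \<nu> - x0 = k\<^sup>2"
    then obtain k :: int where "\<nu>\<^sup>2 - \<nu> - x0 = k\<^sup>2" by blast
    then have "(of_int k)\<^sup>2 = (of_int (\<nu>\<^sup>2 - \<nu>) - x 0)"
      by (metis x_0 of_int_diff of_int_power)
    with ns show False
      using subfield_of_int[OF is_subfield_K, of k 0] by (auto simp: nonsquare_from_def)
  qed
next
  assume k: "\<not> (\<exists>k::int. \<nu>\<^sup>2 - \<nu> - x0 = k\<^sup>2)"
  have "p\<^sup>2 \<noteq> of_int (\<nu>\<^sup>2 - \<nu>) - x 0" if "p \<in> K 0" for p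
    using rat_square_int[of p "\<nu>\<^sup>2 - \<nu> - x0"] that k by (metis K_0 x_0 of_int_diff)
  with nonsquare_from_1[OF assms] show "nonsquare_from 0"
    unfolding nonsquare_from_def by (metis less_one not_le)
qed

section \<open>A quadratic field outside the tower\<close>

text \<open>If \<open>u\<^sub>0 - x\<^sub>0 = k\<^sup>2\<close>, then \<open>x\<^sub>2 + k / x\<^sub>2\<close> is the square root of \<open>2 \<nu> + 2 k\<close>.\<close>

lemma (in sqrt_tower) exotic_square_root:
  fixes k :: int
  assumes k: "\<nu>\<^sup>2 - \<nu> - x0 = k\<^sup>2"
  obtains w where "w\<^sup>2 \<in> K 0" "w \<in> K 2" "adjoin (K 0) w \<notin> range K"
proof -
  have nz: "x 2 \<noteq> 0"
    using x_notin[of 1] subfield_0[OF is_subfield_K] by (auto simp: numeral_2_eq_2)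
  have x2: "(x 2)\<^sup>2 = of_int \<nu> + x 1" and x1: "(x 1)\<^sup>2 = of_int (\<nu> + x0)"
    using x_Suc[of 1] x_Suc[of 0] by (auto simp: numeral_2_eq_2 x_0)
  \<comment> \<open>The square of \<open>of_int k / x 2\<close> is
    \<open>of_int \<nu> - x 1\<close>, so \<open>w\<close> adds square roots of two conjugate
    elements of \<open>K 1\<close>; the terms \<open>x 1\<close> cancel in its square.\<close>
  define w where "w = x 2 + of_int k / x 2"
  have "(of_int k)\<^sup>2 = (of_int \<nu>)\<^sup>2 - (x 1)\<^sup>2"
    unfolding x1 of_int_power[symmetric] of_int_diff[symmetric] k[symmetric] by (simp only: diff_diff_eq)
  also have "\<dots> = (x 2)\<^sup>2 * (of_int \<nu> - x 1)"
    unfolding x2 by (simp add: algebra_simps power2_eq_square)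
  finally have "(of_int k / x 2)\<^sup>2 = of_int \<nu> - x 1"
    using nz by (simp add: power_divide)
  moreover have "w\<^sup>2 = (x 2)\<^sup>2 + (of_int k / x 2)\<^sup>2 + 2 * of_int k"
    using nz by (simp add: w_def power2_sum)
  ultimately have "w\<^sup>2 = of_int (2 * \<nu> + 2 * k)" by (simp add: x2)
  then have w2: "w\<^sup>2 \<in> K 0" using subfield_of_int[OF is_subfield_K] by metis
  have w_K2: "w \<in> K 2"
    unfolding w_def by (intro subfield_add subfield_divide subfield_of_int is_subfield_K x_in_K)
  have x1_in: "x 1 \<in> K 1" by (rule x_in_K)
  have w_notin: "w \<notin> K 1"
  proof
    assume "w \<in> K 1"
    have "w * (x 2)\<^sup>2 = ((x 2)\<^sup>2 + of_int k) * x 2"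
      using nz by (simp add: w_def power2_eq_square algebra_simps)
    then have w: "w * (of_int \<nu> + x 1) = (of_int (\<nu> + k) + x 1) * x 2"
      unfolding x2 by (simp add: algebra_simps)
    have c: "of_int (\<nu> + k) + x 1 \<noteq> 0"
    proof
      assume "of_int (\<nu> + k) + x 1 = 0"
      then have "x (Suc 0) = of_int (- (\<nu> + k))" by (simp add: add_eq_0_iff)
      then show False using x_notin[of 0] subfield_of_int[OF is_subfield_K] by metis
    qed
    have "x 2 = w * (of_int \<nu> + x 1) / (of_int (\<nu> + k) + x 1)"
      using w c by simp
    then have "x 2 \<in> K 1"
      using \<open>w \<in> K 1\<close> x1_in
      by (simp only:) (intro subfield_add subfield_divide subfield_mult subfield_of_int is_subfield_K)
    then show False using x_notin[of 1] by (simp add: numeral_2_eq_2)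
  qed
  \<comment> \<open>As \<open>w\<close> is not in \<open>K 1\<close>, equality needs
    \<open>j \<ge> 2\<close>. Then \<open>x 1 = a + b * w\<close> with rational \<open>a\<close>,
    \<open>b\<close>, and solving for \<open>w\<close> puts it back in \<open>K 1\<close>.\<close>
  have "adjoin (K 0) w \<noteq> K j" for j
  proof
    assume eq: "adjoin (K 0) w = K j"
    then have "w \<in> K j" using mem_adjoin[OF is_subfield_K] by blast
    then have "\<not> j \<le> 1" using w_notin K_mono by blast
    then have "x 1 \<in> adjoin (K 0) w" using eq x1_in K_mono[of 1 j] by auto
    then obtain a b where ab: "a \<in> K 0" "b \<in> K 0" "x 1 = a + b * w" by (elim adjoinE)
    with x_notin[of 0] have "b \<noteq> 0" by auto
    then have "w = (x 1 - a) / b" using ab by simp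
    moreover have "a \<in> K 1" "b \<in> K 1" using ab K_mono[of 0 1] by auto
    ultimately have "w \<in> K 1"
      using x1_in by (simp only:) (intro subfield_divide subfield_diff is_subfield_K)
    with w_notin show False ..
  qed
  then show ?thesis using that w2 w_K2 by blast
qed

text \<open>Each \<open>x (Suc n)\<close> is new over \<open>K n\<close>, so it can be sent to
  either root; every choice of signs thus comes from an embedding. This lets total reality be tested
  on a convenient conjugate sequence.\<close>

lemma (in sqrt_tower) embedding_exists:
  fixes y :: "nat \<Rightarrow> 'a"
  assumes y_0: "y 0 = of_int x0" and y_Suc: "\<And>n. (y (Suc n))\<^sup>2 = of_int \<nu> + y n"
  obtains \<sigma> where "field_hom_on (\<Union>n. K n) \<sigma>" "\<And>n. \<sigma> (x n) = y n"
proof -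
  have "\<exists>f. \<forall>n. (field_hom_on (K n) (f n) \<and> f n (x n) = y n) \<and> (\<forall>z\<in>K n. f (Suc n) z = f n z)"
  proof (rule dependent_nat_choice)
    show "\<exists>g. field_hom_on (K 0) g \<and> g (x 0) = y 0"
      by (rule exI[of _ "\<lambda>z. z"]) (simp add: field_hom_on_def x_0 y_0)
  next
    fix g n assume g: "field_hom_on (K n) g \<and> g (x n) = y n"
    then have "g (of_int \<nu> + x n) = g (of_int \<nu>) + g (x n)"
      using subfield_of_int[OF is_subfield_K] x_in_K by (auto simp: field_hom_on_def)
    then have "(y (Suc n))\<^sup>2 = g ((x (Suc n))\<^sup>2)"
      using g field_hom_on_of_int[OF is_subfield_K conjunct1[OF g]] by (simp add: x_Suc y_Suc)
    then show "\<exists>g'. (field_hom_on (K (Suc n)) g' \<and> g' (x (Suc n)) = y (Suc n)) \<and> (\<forall>z\<in>K n. g' z = g z)"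
      using field_hom_extend[OF is_subfield_K _ x_notin x_Suc_square_in_K] g
      by (metis K_Suc)
  qed
  then obtain f where f: "\<And>n. field_hom_on (K n) (f n)" "\<And>n. f n (x n) = y n"
    "\<And>n z. z \<in> K n \<Longrightarrow> f (Suc n) z = f n z" by blast
  have f_le: "f n z = f m z" if "m \<le> n" "z \<in> K m" for m n z
    using that(1)
  proof (induction n rule: dec_induct)
    case (step n)
    then show ?case using f(3) K_mono[of m n] that(2) by auto
  qed simp
  \<comment> \<open>The level maps agree where they overlap, so the least level containing
    \<open>z\<close> is just one valid choice.\<close>
  define \<sigma> where "\<sigma> z = f (LEAST n. z \<in> K n) z" for z
  have \<sigma>: "\<sigma> z = f n z" if "z \<in> K n" for n z
    unfolding \<sigma>_def using f_le[of "LEAST n. z \<in> K n" n z] LeastI[of "\<lambda>n. z \<in> K n", OF that]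
      Least_le[of "\<lambda>n. z \<in> K n", OF that] by simp
  have "\<sigma> (a + b) = \<sigma> a + \<sigma> b \<and> \<sigma> (a * b) = \<sigma> a * \<sigma> b"
    if "a \<in> (\<Union>n. K n)" "b \<in> (\<Union>n. K n)" for a b
  proof -
    obtain m n where "a \<in> K m" "b \<in> K n" using \<open>a \<in> _\<close> \<open>b \<in> _\<close> by blast
    then have ab: "a \<in> K (max m n)" "b \<in> K (max m n)"
      using K_mono[of m "max m n"] K_mono[of n "max m n"] by auto
    then have "a + b \<in> K (max m n)" "a * b \<in> K (max m n)"
      by (auto intro: subfield_add subfield_mult is_subfield_K)
    with ab f(1)[of "max m n"] show ?thesis by (auto simp: \<sigma> field_hom_on_def)
  qed
  moreover have "\<sigma> 1 = 1"
    using \<sigma>[OF subfield_1[OF is_subfield_K]] f(1) by (auto simp: field_hom_on_def)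
  ultimately have "field_hom_on (\<Union>n. K n) \<sigma>" by (simp add: field_hom_on_def)
  moreover have "\<sigma> (x n) = y n" for n using \<sigma>[OF x_in_K] f(2) by metis
  ultimately show ?thesis using that by blast
qed


section \<open>The ring of complex numbers\<close>

lemma complex_ring_simps [simp]:
  "carrier complex_ring = UNIV" "\<zero>\<^bsub>complex_ring\<^esub> = 0" "\<one>\<^bsub>complex_ring\<^esub> = 1"
  "a \<oplus>\<^bsub>complex_ring\<^esub> b = a + b" "a \<otimes>\<^bsub>complex_ring\<^esub> b = a * b"
  by (simp_all add: ring_of_type_algebra_def)

interpretation complex_ring: cring complex_ring
  by (rule cring_from_type_algebra)

lemma complex_ring_a_inv [simp]: "\<ominus>\<^bsub>complex_ring\<^esub> a = - a"
  by (rule complex_ring.minus_equality) simp_all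

lemma complex_ring_m_inv [simp]: "a \<noteq> 0 \<Longrightarrow> inv\<^bsub>complex_ring\<^esub> a = inverse a"
  by (rule complex_ring.comm_inv_char) simp_all

lemma subfield_complex_ring_iff: "subfield L complex_ring \<longleftrightarrow> is_subfield L"
proof
  assume L: "subfield L complex_ring"
  note cl = subringE[OF subfieldE(1)[OF L], simplified]
  have "inverse a \<in> L" if "a \<in> L" for a
    using complex_ring.subfield_m_inv(1)[OF L, of a] that cl(2) by (cases "a = 0") auto
  moreover have "a - b \<in> L" if "a \<in> L" "b \<in> L" for a b
    using cl(7)[OF that(1) cl(5)[OF that(2)]] by simp
  ultimately show "is_subfield L"
    using cl by (simp add: is_subfield_def)
next
  assume L: "is_subfield L"
  show "subfield L complex_ring"
    by (rule field.subfieldI'[OF field_from_type_algebra], rule complex_ring.subringI)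
      (auto simp: subfield_closed[OF L])
qed

lemma finite_dimension_adjoin:
  assumes F: "is_subfield F"
  shows "complex_ring.finite_dimension F (adjoin F w)"
proof -
  have "complex_ring.line_extension F 1 {0} = F"
    by (auto simp: complex_ring.line_extension_mem_iff)
  then have "z \<in> complex_ring.Span F [w, 1] \<longleftrightarrow> (\<exists>k\<in>F. \<exists>v\<in>F. z = k * w + v)" for z
    by (simp add: complex_ring.line_extension_mem_iff)
  then have "complex_ring.Span F [w, 1] = adjoin F w"
    unfolding adjoin_def by (auto simp: add.commute)
  then show ?thesis
    using complex_ring.Span_finite_dimension[of F "[w, 1]"] F
    by (simp add: subfield_complex_ring_iff)
qed

lemma nested_root_Suc_square:
  "(nested_root s \<nu> x0 (Suc n))\<^sup>2 = of_int \<nu> + nested_root s \<nu> x0 n"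
  by simp

text \<open>The fields increase because x_n is the square of x_(n+1) minus \<nu>, so adjoining
  x_(n+1) to \<open>K n\<close> gives \<open>K (Suc n)\<close>. If x_(n+1) were in
  \<open>K n\<close>, the two levels would coincide and the dimension would be 1 instead of
  2.\<close>

lemma Omega_sqrt_tower:
  assumes "(\<nu>, x0) \<in> Omega s"
  shows "sqrt_tower \<nu> x0 (nested_root s \<nu> x0) (tower_field s \<nu> x0)"
proof -
  define x K where "x = nested_root s \<nu> x0" and "K = tower_field s \<nu> x0"
  have x_Suc: "(x (Suc n))\<^sup>2 = of_int \<nu> + x n" for n
    unfolding x_def by (rule nested_root_Suc_square)
  have F: "is_subfield (K n)" and x_K: "x n \<in> K n"
    and min: "\<And>E. is_subfield E \<Longrightarrow> x n \<in> E \<Longrightarrow> K n \<subseteq> E" for n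
  proof -
    show "is_subfield (K n)"
      using field.generate_field_is_subfield[OF field_from_type_algebra, of "\<rat> \<union> {x n}"]
      by (simp add: K_def x_def tower_field_def subfield_complex_ring_iff)
    show "x n \<in> K n"
      by (auto simp: K_def x_def tower_field_def intro: generate_field.incl)
    show "K n \<subseteq> E" if "is_subfield E" "x n \<in> E" for E
      using field.generate_field_min_subfield1[OF field_from_type_algebra, of "\<rat> \<union> {x n}" E] that
        Rats_subset_subfield[OF that(1)]
      by (simp add: K_def x_def tower_field_def subfield_complex_ring_iff)
  qed
  have K_le: "K n \<subseteq> K (Suc n)" for n
  proof (rule min[OF F])
    have "x n = (x (Suc n))\<^sup>2 - of_int \<nu>" by (simp add: x_Suc)
    then show "x n \<in> K (Suc n)"
      by (simp only:) (intro subfield_diff subfield_power subfield_of_int F x_K)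
  qed
  have K_Suc: "K (Suc n) = adjoin (K n) (x (Suc n))" for n
  proof
    have "(x (Suc n))\<^sup>2 \<in> K n"
      unfolding x_Suc by (intro subfield_add subfield_of_int F x_K)
    then show "K (Suc n) \<subseteq> adjoin (K n) (x (Suc n))"
      by (intro min is_subfield_adjoin mem_adjoin F)
    show "adjoin (K n) (x (Suc n)) \<subseteq> K (Suc n)"
      by (intro adjoin_subset F K_le x_K)
  qed
  have "x (Suc n) \<notin> K n" for n
  proof
    assume "x (Suc n) \<in> K n"
    then have "K (Suc n) = K n" by (simp add: K_Suc adjoin_absorb F)
    moreover have "complex_ring.dimension 2 (K n) (K (Suc n))"
      using assms by (simp add: Omega_def K_def)
    ultimately have "complex_ring.dimension 2 (K n) (K n)" by simp
    moreover have sf: "subfield (K n) complex_ring" by (simp add: subfield_complex_ring_iff F)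
    ultimately have "(2::nat) = 1"
      using complex_ring.dimension_is_inj complex_ring.dimension_one by blast
    then show False by simp
  qed
  moreover have "K 0 = \<rat>"
    using min[OF is_subfield_Rats, of 0] Rats_subset_subfield[OF F[of 0]] by (auto simp: x_def)
  ultimately have "sqrt_tower \<nu> x0 x K"
    using x_Suc K_Suc by unfold_locales (auto simp: x_def)
  then show ?thesis by (simp add: x_def K_def)
qed

text \<open>The conjugate \<open>\<surd>(\<nu> - \<surd>(\<nu> + x\<^sub>0))\<close> of \<open>x\<^sub>2\<close> has to be real.\<close>

lemma Omega_x0_le:
  assumes "(\<nu>, x0) \<in> Omega s"
  shows "x0 \<le> \<nu>\<^sup>2 - \<nu>"
proof -
  interpret sqrt_tower \<nu> x0 "nested_root s \<nu> x0" "tower_field s \<nu> x0"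
    using assms by (rule Omega_sqrt_tower)
  \<comment> \<open>With all signs negative, the square of \<open>y 2\<close> is \<nu> minus the
    real root of \<nu> + x0. Reality of \<open>y 2\<close> bounds that root by \<nu>.\<close>
  define y where "y = nested_root (\<lambda>_. False) \<nu> x0"
  have \<nu>: "\<nu> \<ge> 2" "x0 \<ge> 0" and tr: "totally_real (\<Union>n. tower_field s \<nu> x0 n)"
    using assms by (auto simp: Omega_def)
  obtain \<sigma> where \<sigma>: "field_hom_on (\<Union>n. tower_field s \<nu> x0 n) \<sigma>"
    "\<And>n. \<sigma> (nested_root s \<nu> x0 n) = y n"
    using embedding_exists[of y] nested_root_Suc_square unfolding y_def
    by (metis nested_root.simps(1))
  have "\<sigma> \<in> ring_hom (complex_ring\<lparr>carrier := \<Union>n. tower_field s \<nu> x0 n\<rparr>) complex_ring"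
    using \<sigma>(1) by (intro ring_hom_memI) (auto simp: field_hom_on_def)
  with tr have "\<sigma> ` (\<Union>n. tower_field s \<nu> x0 n) \<subseteq> \<real>"
    unfolding totally_real_def by blast
  then have "y 2 \<in> \<real>" using \<sigma>(2)[of 2] x_in_K[of 2] by (metis UN_I UNIV_I image_subset_iff)
  then obtain r where r: "y 2 = of_real r" by (elim Reals_cases)
  have "y 1 = - of_real (sqrt (real_of_int (\<nu> + x0)))"
    using \<nu> csqrt_of_real_nonneg[of "complex_of_int (\<nu> + x0)"] by (simp add: y_def)
  moreover have "(y 2)\<^sup>2 = of_int \<nu> + y 1"
    using nested_root_Suc_square[of _ \<nu> x0 1] by (simp only: y_def numeral_2_eq_2 One_nat_def)
  ultimately have "complex_of_real (r\<^sup>2) = of_real (real_of_int \<nu> - sqrt (real_of_int (\<nu> + x0)))"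
    by (simp add: r)
  then have "r\<^sup>2 = real_of_int \<nu> - sqrt (real_of_int (\<nu> + x0))"
    by (simp only: of_real_eq_iff)
  then have "sqrt (real_of_int (\<nu> + x0)) \<le> real_of_int \<nu>"
    by (metis diff_ge_0_iff_ge zero_le_power2)
  then have "real_of_int (\<nu> + x0) \<le> real_of_int (\<nu>\<^sup>2)"
    by (simp add: sqrt_le_D)
  then show ?thesis by linarith
qed

theorem theorem4p7:
  fixes \<nu> x0 u0 :: int and s :: "nat \<Rightarrow> bool"
  assumes "(\<nu>, x0) \<in> Omega s"
    and "u0 = \<nu>\<^sup>2 - \<nu>"
  shows "thin_tower (tower_field s \<nu> x0) 1 \<and>
    (thin_tower (tower_field s \<nu> x0) 0 \<longleftrightarrow> \<not> (\<exists>k::int. u0 - x0 = k\<^sup>2))"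
proof -
  define K where "K = tower_field s \<nu> x0"
  interpret sqrt_tower \<nu> x0 "nested_root s \<nu> x0" K
    unfolding K_def using assms(1) by (rule Omega_sqrt_tower)
  have bounds: "\<nu> \<ge> 2" "0 \<le> x0" "x0 \<le> \<nu>\<^sup>2 - \<nu>"
    using assms(1) Omega_x0_le by (auto simp: Omega_def)
  have sf: "subfield (K n) complex_ring" for n
    by (simp add: subfield_complex_ring_iff is_subfield_K)
  have fin: "complex_ring.finite_dimension (K m) (K n)" if "m \<le> n" for m n
    using that
  proof (induction n rule: dec_induct)
    case base
    show ?case using complex_ring.finite_dimensionI complex_ring.dimension_one sf by blast
  next
    case (step n)
    moreover have "complex_ring.dimension 2 (K n) (K (Suc n))"
      using assms(1) by (simp add: Omega_def K_def)
    ultimately show ?case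
      using complex_ring.telescopic_base[OF sf sf] complex_ring.finite_dimension_def by metis
  qed
  have thin: "thin_tower K m" if ns: "nonsquare_from m" for m
    unfolding thin_tower_def
  proof (intro subset_antisym subsetI)
    fix L assume "L \<in> {L. subfield L complex_ring \<and> K m \<subseteq> L \<and>
      complex_ring.finite_dimension (K m) L \<and> L \<subseteq> (\<Union>n. K n)}"
    then have L: "is_subfield L" "K m \<subseteq> L" "complex_ring.finite_dimension (K m) L" "L \<subseteq> (\<Union>n. K n)"
      by (auto simp: subfield_complex_ring_iff)
    \<comment> \<open>A finite spanning list lies in a single level \<open>K n\<close>, and with it
      all of \<open>L\<close>; this reduces the claim to \<open>intermediate_field\<close>.\<close>
    obtain Us where Us: "complex_ring.Span (K m) Us = L"
      using L(3) complex_ring.exists_base[OF sf] by (metis complex_ring.finite_dimension_def)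
    have "\<exists>n\<ge>m. set Vs \<subseteq> K n" if "set Vs \<subseteq> (\<Union>n. K n)" for Vs
      using that
    proof (induction Vs)
      case (Cons v Vs)
      then obtain n i where "m \<le> n" "set Vs \<subseteq> K n" "v \<in> K i" by auto
      then have "m \<le> max n i" "set (v # Vs) \<subseteq> K (max n i)"
        using K_mono[of n "max n i"] K_mono[of i "max n i"] by auto
      then show ?case by blast
    qed auto
    moreover have "set Us \<subseteq> (\<Union>n. K n)"
      using complex_ring.Span_base_incl[OF sf, of Us m] Us L(4) by auto
    ultimately obtain n where n: "m \<le> n" "set Us \<subseteq> K n" by blast
    have "complex_ring.Span (K m) Vs \<subseteq> K n" if "set Vs \<subseteq> K n" for Vs
      using that
    proof (induction Vs)
      case Nil
      then show ?case by (simp add: subfield_0 is_subfield_K)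
    next
      case (Cons v Vs)
      show ?case
      proof
        fix z assume "z \<in> complex_ring.Span (K m) (v # Vs)"
        then obtain a b where "a \<in> K m" "b \<in> complex_ring.Span (K m) Vs" "z = a * v + b"
          by (auto simp: complex_ring.line_extension_mem_iff)
        then show "z \<in> K n"
          using Cons K_mono[OF n(1)]
          by (auto intro!: subfield_add[OF is_subfield_K] subfield_mult[OF is_subfield_K])
      qed
    qed
    then have "L \<subseteq> K n" using Us n(2) by blast
    then show "L \<in> K ` {m..}"
      using intermediate_field[OF ns n(1) L(1,2)] by auto
  next
    fix L assume "L \<in> K ` {m..}"
    then show "L \<in> {L. subfield L complex_ring \<and> K m \<subseteq> L \<and>
      complex_ring.finite_dimension (K m) L \<and> L \<subseteq> (\<Union>n. K n)}"
      using sf fin K_mono by blast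
  qed
  have not_thin: "\<not> thin_tower K 0" if k: "\<nu>\<^sup>2 - \<nu> - x0 = k\<^sup>2" for k :: int
  proof
    assume "thin_tower K 0"
    obtain w where w: "w\<^sup>2 \<in> K 0" "w \<in> K 2" "adjoin (K 0) w \<notin> range K"
      using exotic_square_root[OF k] by blast
    have "adjoin (K 0) w \<subseteq> K 2"
      using w K_mono[of 0 2] by (intro adjoin_subset is_subfield_K) auto
    then have "adjoin (K 0) w \<in> {L. subfield L complex_ring \<and> K 0 \<subseteq> L \<and>
        complex_ring.finite_dimension (K 0) L \<and> L \<subseteq> (\<Union>n. K n)}"
      using w(1) by (auto simp: subfield_complex_ring_iff is_subfield_adjoin is_subfield_K
          finite_dimension_adjoin subset_adjoin[THEN subsetD])
    with \<open>thin_tower K 0\<close> w(3) show False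
      unfolding thin_tower_def by auto
  qed
  show ?thesis
    using thin[OF nonsquare_from_1[OF bounds]] thin[of 0] not_thin nonsquare_from_0_iff[OF bounds]
    unfolding assms(2) K_def by blast
qed

end
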